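(* Let $M \ge 2$, $N, K, T \ge 1$ be integers, $\sigma > 0$, $P > 0$, let $\boldsymbol{h}_1,\ldots,\boldsymbol{h}_K \in \mathbb{C}^N$, let $s_{i,t} \in \mathcal{S}$ for $i = 1,\ldots,K$, $t=1,\ldots,T$, and let $\boldsymbol{x}_t \in \mathcal{X} = \left\{ \pm\sqrt{\tfrac{P}{2N}} \pm \sqrt{\tfrac{P}{2N}}\, j \right\}^N$ for $t = 1,\ldots,T$. Let $y_{i,t} = \boldsymbol{h}_i^T \boldsymbol{x}_t + \eta_{i,t}$, where each $\eta_{i,t}$ is circular complex Gaussian with mean zero and variance $\sigma^2$, and let $\hat{s}_{i,t} = \mathrm{dec}(y_{i,t})$. Then for all $i = 1,\ldots,K$ and $t = 1,\ldots,T$, the symbol error probability ${\sf SEP}_{i,t} = \Pr(\hat{s}_{i,t} \neq s_{i,t} \mid s_{i,t})$ satisfies $${\sf SEP}_{i,t} \le 2 Q\left( \frac{\alpha_{i,t}}{\sigma/\sqrt{2}} \sin\frac{\pi}{M} \right),$$ where $$\alpha_{i,t} = \Re\{ \boldsymbol{h}_i^T \boldsymbol{x}_t s_{i,t}^{*} \} - \left|\Im\{ \boldsymbol{h}_i^T \boldsymbol{x}_t s_{i,t}^{*} \}\right| \cot\left(\frac{\pi}{M}\right).$$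
   Context: Here $j$ is the imaginary unit, $\Re\{\cdot\},\Im\{\cdot\}$ denote real and imaginary parts, $(\cdot)^*$ is complex conjugation, and $(\cdot)^T$ is the (non-conjugate) transpose. A circular complex Gaussian random variable with mean zero and variance $\sigma^2$ has independent real and imaginary parts, each distributed as $N(0,\sigma^2/2)$. The set $\mathcal{X}$ consists of vectors each of whose $N$ entries independently takes one of the four values $\pm\sqrt{P/(2N)} \pm \sqrt{P/(2N)}\,j$. The $M$-ary PSK constellation is $\mathcal{S} = \{ e^{j n \frac{2\pi}{M}} : n = 0,\ldots,M-1 \}$. The decision function $\mathrm{dec}: \mathbb{C} \to \mathcal{S}$ is $\mathrm{dec}(y) = e^{j\hat{n}\frac{2\pi}{M}}$, where $\hat{n} \in \{0,\ldots,M-1\}$ is such that the phase angle of $y$ (modulo $2\pi$) lies in $\left[\frac{2\pi\hat{n}}{M} - \frac{\pi}{M}, \frac{2\pi\hat{n}}{M} + \frac{\pi}{M}\right]$; ties on the boundaries of these sectors (including $y=0$), a Lebesgue-null set, may be resolved by any fixed measurable rule. The symbols $s_{i,t}$, channels $\boldsymbol{h}_i$ and transmitted vectors $\boldsymbol{x}_t$ are treated as given (fixed); the probability in ${\sf SEP}_{i,t}$ is over the noise $\eta_{i,t}$ only. The function $Q$ is $Q(x) = \int_x^\infty \frac{1}{\sqrt{2\pi}} e^{-u^2/2}\, du$ for $x \in \mathbb{R}$. *)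

theory Defs
  imports "HOL-Probability.Probability"
begin

definition tdot :: "complex ^ 'n::finite \<Rightarrow> complex ^ 'n \<Rightarrow> complex" where
  "tdot h x = (\<Sum>r\<in>UNIV. h $ r * x $ r)"  \<comment> \<open>no conjugation: this is not the Hermitian inner product\<close>

definition psk_point :: "nat \<Rightarrow> nat \<Rightarrow> complex" where
  "psk_point M n = exp (\<i> * complex_of_real (real n * (2 * pi / real M)))"

definition psk :: "nat \<Rightarrow> complex set" where
  "psk M = psk_point M ` {0..<M}"

text \<open>The predicate leaves the choice between the two symbols on a common sector boundary open.
  Every real number satisfies \<^term>\<open>is_Arg 0\<close>, so any symbol is admissible at the origin.\<close>

definition psk_decision :: "nat \<Rightarrow> (complex \<Rightarrow> complex) \<Rightarrow> bool" where
  "psk_decision M dec \<longleftrightarrow>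
     dec \<in> borel_measurable borel \<and>
     (\<forall>y. \<exists>n\<in>{0..<M}. dec y = psk_point M n \<and>
        (\<exists>\<theta>\<in>{2 * pi * real n / real M - pi / real M .. 2 * pi * real n / real M + pi / real M}.
           is_Arg y \<theta>))"

definition one_bit_signals :: "real \<Rightarrow> (complex ^ 'n::finite) set" where
  "one_bit_signals P =
     (let c = sqrt (P / (2 * real CARD('n)))
      in {x. \<forall>r. x $ r \<in> {Complex a b | a b. a \<in> {c, -c} \<and> b \<in> {c, -c}}})"

text \<open>The parameter \<open>v\<close> is the variance of the complex variable, whereas the second parameter of
  \<^const>\<open>normal_density\<close> is a standard deviation.\<close>

definition circular_complex_gaussian :: "'w measure \<Rightarrow> ('w \<Rightarrow> complex) \<Rightarrow> real \<Rightarrow> bool" where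
  "circular_complex_gaussian \<Omega> Z v \<longleftrightarrow>
     Z \<in> borel_measurable \<Omega> \<and>
     prob_space.indep_var \<Omega> borel (\<lambda>\<omega>. Re (Z \<omega>)) borel (\<lambda>\<omega>. Im (Z \<omega>)) \<and>
     distributed \<Omega> lborel (\<lambda>\<omega>. Re (Z \<omega>)) (normal_density 0 (sqrt (v / 2))) \<and>
     distributed \<Omega> lborel (\<lambda>\<omega>. Im (Z \<omega>)) (normal_density 0 (sqrt (v / 2)))"

definition Q :: "real \<Rightarrow> real" where
  "Q x = (LINT u:{x..}|lborel. 1 / sqrt (2 * pi) * exp (- u\<^sup>2 / 2))"

definition SEP :: "'w measure \<Rightarrow> (complex \<Rightarrow> complex) \<Rightarrow> ('w \<Rightarrow> complex) \<Rightarrow> complex \<Rightarrow> real" where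
  "SEP \<Omega> dec y s = measure \<Omega> {\<omega> \<in> space \<Omega>. dec (y \<omega>) \<noteq> s}"

definition safety_margin :: "nat \<Rightarrow> complex \<Rightarrow> complex \<Rightarrow> real" where
  "safety_margin M z s = Re (z * cnj s) - \<bar>Im (z * cnj s)\<bar> * cot (pi / real M)"

end

theory Submission
  imports Defs
begin

text \<open>After derotation by the conjugate of the sent symbol, the decision region of that symbol
  contains the open sector of half-angle \<open>\<pi> / M\<close> around the positive real axis. For \<open>M \<ge> 2\<close> this
  sector is convex, an intersection of two half-planes, and the safety margin times \<open>sin (\<pi> / M)\<close> is
  the smaller of the signed distances from the noiseless signal to the two boundary lines. An error
  therefore forces the component of the noise along one of two unit vectors to reach that distance;
  by circular symmetry each component is Gaussian with variance \<open>\<sigma>\<^sup>2 / 2\<close>, and the union bound gives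
  the factor 2.\<close>

text \<open>Rotation invariance of the noise: the scaled terms are independent normals, so their
  variances add to \<open>(a\<^sup>2 + b\<^sup>2) * \<tau>\<^sup>2\<close>, which is
  \<open>\<tau>\<^sup>2\<close> for a unit vector \<open>(a, b)\<close>.\<close>

lemma (in prob_space) distributed_normal_linear_combination:
  fixes X Y :: "'a \<Rightarrow> real"
  assumes indep: "indep_var borel X borel Y"
    and X: "distributed M lborel X (normal_density 0 \<tau>)"
    and Y: "distributed M lborel Y (normal_density 0 \<tau>)"
    and \<tau>: "0 < \<tau>" and ab: "a\<^sup>2 + b\<^sup>2 = 1"
  shows "distributed M lborel (\<lambda>w. a * X w + b * Y w) (normal_density 0 \<tau>)"
proof -
  have aX: "distributed M lborel (\<lambda>w. a * X w) (normal_density 0 (\<bar>a\<bar> * \<tau>))" if "a \<noteq> 0"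
    using normal_density_affine[OF X \<tau> that, of 0] by simp
  have bY: "distributed M lborel (\<lambda>w. b * Y w) (normal_density 0 (\<bar>b\<bar> * \<tau>))" if "b \<noteq> 0"
    using normal_density_affine[OF Y \<tau> that, of 0] by simp
  \<comment> \<open>A vanishing coefficient needs its own case, because the constant 0 has no
    density; the other coefficient is then 1 or -1.\<close>
  consider "a = 0" | "b = 0" | "a \<noteq> 0" "b \<noteq> 0" by blast
  then show ?thesis
  proof cases
    case 1
    then have "\<bar>b\<bar> = 1" using ab by (auto simp: power2_eq_1_iff)
    then show ?thesis using bY 1 by fastforce
  next
    case 2
    then have "\<bar>a\<bar> = 1" using ab by (auto simp: power2_eq_1_iff)
    then show ?thesis using aX 2 by fastforce
  next
    case 3
    have "indep_var borel ((\<lambda>x. a * x) \<circ> X) borel ((\<lambda>x. b * x) \<circ> Y)"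
      by (rule indep_var_compose[OF indep]) simp_all
    then have ind: "indep_var borel (\<lambda>w. a * X w) borel (\<lambda>w. b * Y w)"
      by (simp add: comp_def)
    have "distributed M lborel (\<lambda>w. a * X w + b * Y w)
            (normal_density (0 + 0) (sqrt ((\<bar>a\<bar> * \<tau>)\<^sup>2 + (\<bar>b\<bar> * \<tau>)\<^sup>2)))"
      by (rule add_indep_normal[OF ind _ _ aX[OF 3(1)] bY[OF 3(2)]]) (use 3 \<tau> in auto)
    moreover have "(\<bar>a\<bar> * \<tau>)\<^sup>2 + (\<bar>b\<bar> * \<tau>)\<^sup>2 = (a\<^sup>2 + b\<^sup>2) * \<tau>\<^sup>2"
      by (simp add: power_mult_distrib algebra_simps)
    ultimately show ?thesis using ab \<tau> by simp
  qed
qed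

lemma (in prob_space) prob_normal_ge:
  assumes X: "distributed M lborel X (normal_density 0 \<tau>)" and \<tau>: "0 < \<tau>"
  shows "prob {w \<in> space M. c \<le> X w} = Q (c / \<tau>)"
proof -
  have "distributed M lborel (\<lambda>w. X w / \<tau>) std_normal_density"
    using X normal_standard_normal_convert[OF \<tau>, of X 0] by simp
  \<comment> \<open>The expectation of one indicator is computed twice: against the standard normal
    density it is \<open>Q\<close>, on the probability space it is the tail probability.\<close>
  from distributed_integral[OF this, of "indicator {c / \<tau>..} :: real \<Rightarrow> real"]
  have "Q (c / \<tau>) = (\<integral>w. indicator {c / \<tau>..} (X w / \<tau>) \<partial>M)"
    by (simp add: Q_def set_lebesgue_integral_def std_normal_density_def mult.commute)
  also have "\<dots> = (\<integral>w. indicator {w \<in> space M. c \<le> X w} w \<partial>M)"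
    using \<tau> by (intro Bochner_Integration.integral_cong)
      (auto simp: indicator_def divide_le_cancel)
  also have "\<dots> = prob {w \<in> space M. c \<le> X w}"
    by (simp add: Int_absorb2)
  finally show ?thesis by simp
qed

lemma prob_circular_complex_gaussian_halfplane:
  assumes "prob_space \<Omega>" and Z: "circular_complex_gaussian \<Omega> Z v" and "0 < v" and u: "cmod u = 1"
  shows "measure \<Omega> {w \<in> space \<Omega>. Re (u * Z w) \<le> - c} = Q (c / sqrt (v / 2))"
proof -
  interpret prob_space \<Omega> by fact
  \<comment> \<open>The coefficients are those of \<open>- Re (u * Z w)\<close>, which turns the
    event into an upper tail.\<close>
  have "(- Re u)\<^sup>2 + (Im u)\<^sup>2 = 1"
    using u by (metis cmod_power2 one_power2 power2_minus)
  then have "distributed \<Omega> lborel (\<lambda>w. - Re u * Re (Z w) + Im u * Im (Z w))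
      (normal_density 0 (sqrt (v / 2)))"
    using Z \<open>0 < v\<close> unfolding circular_complex_gaussian_def
    by (intro distributed_normal_linear_combination) auto
  from prob_normal_ge[OF this, of c] show ?thesis
    using \<open>0 < v\<close> by (simp add: algebra_simps le_diff_eq)
qed

text \<open>The bounds on \<open>k\<close> place \<open>\<psi>\<close> in the interval from
  \<open>\<phi>\<close> to \<open>2 * pi - \<phi>\<close>. Up to \<open>pi + \<phi>\<close> the
  angle \<open>\<psi> - \<phi>\<close> lies in the upper half circle; beyond that,
  \<open>\<phi> + \<psi>\<close> lies between \<open>pi\<close> and \<open>2 * pi\<close>.\<close>

lemma sin_nonpos_outside_sector:
  fixes k :: int and M :: nat
  assumes M: "M \<ge> 1" and \<phi>: "\<phi> = pi / real M" and k: "1 \<le> k" "k \<le> int M - 1"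
    and \<psi>: "\<psi> \<in> {2 * of_int k * \<phi> - \<phi> .. 2 * of_int k * \<phi> + \<phi>}"
  shows "sin (\<phi> - \<psi>) \<le> 0 \<or> sin (\<phi> + \<psi>) \<le> 0"
proof -
  have "\<phi> > 0" using M \<phi> by simp
  have kr: "1 \<le> real_of_int k" "real_of_int k \<le> real M - 1" using k by linarith+
  have lo: "\<phi> \<le> real_of_int k * \<phi>" using kr \<open>\<phi> > 0\<close> by simp
  have "real_of_int k * \<phi> \<le> (real M - 1) * \<phi>" using kr \<open>\<phi> > 0\<close> by (intro mult_right_mono) auto
  then have hi: "real_of_int k * \<phi> + \<phi> \<le> pi" using M unfolding left_diff_distrib by (simp add: \<phi>)
  show ?thesis
  proof (cases "\<psi> - \<phi> \<le> pi")
    case True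
    then have "0 \<le> sin (\<psi> - \<phi>)" using \<psi> lo by (intro sin_ge_zero) auto
    then show ?thesis using sin_minus[of "\<psi> - \<phi>"] by simp
  next
    case False
    then have "0 \<le> sin (\<phi> + \<psi> - pi)" using \<psi> lo hi \<open>\<phi> > 0\<close> by (intro sin_ge_zero) auto
    then show ?thesis by (simp add: sin_diff)
  qed
qed

text \<open>A wrong decision puts the derotated angle into the closed sector around a nonzero
  multiple of \<open>2 * pi / M\<close>, hence on or beyond one of the two lines that bound the
  sector of the sent symbol.\<close>

lemma psk_decision_error:
  assumes M: "M \<ge> 2" and dec: "psk_decision M dec" and s: "s \<in> psk M" and err: "dec y \<noteq> s"
  shows "Re (y * cnj s) * sin (pi / real M) \<le> \<bar>Im (y * cnj s)\<bar> * cos (pi / real M)"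
proof -
  define \<phi> where "\<phi> = pi / real M"
  obtain m where m: "m < M" "s = psk_point M m" using s by (auto simp: psk_def)
  obtain n \<theta> where n: "n < M" "dec y = psk_point M n" "is_Arg y \<theta>"
    and \<theta>: "\<theta> \<in> {2 * pi * real n / real M - pi / real M .. 2 * pi * real n / real M + pi / real M}"
    using dec unfolding psk_decision_def by (meson atLeastLessThan_iff)
  define k where "k = int n - int m"
  define \<psi> where "\<psi> = \<theta> - 2 * real m * \<phi>"
  have "k \<noteq> 0" using err m n by (auto simp: k_def)
  have \<psi>: "\<psi> \<in> {2 * of_int k * \<phi> - \<phi> .. 2 * of_int k * \<phi> + \<phi>}"
    using \<theta> by (simp add: \<psi>_def \<phi>_def k_def algebra_simps diff_divide_distrib)
  have sines: "sin (\<phi> - \<psi>) \<le> 0 \<or> sin (\<phi> + \<psi>) \<le> 0"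
  proof (cases "k \<ge> 1")
    case True
    show ?thesis
      by (rule sin_nonpos_outside_sector[OF _ \<phi>_def True _ \<psi>]) (use M m n k_def in auto)
  next
    \<comment> \<open>Reflection in the real axis negates \<open>k\<close> and \<open>\<psi>\<close>
      and swaps the two sines, so negative \<open>k\<close> reduces to positive
      \<open>k\<close>.\<close>
    case False
    have "sin (\<phi> - (- \<psi>)) \<le> 0 \<or> sin (\<phi> + (- \<psi>)) \<le> 0"
      by (rule sin_nonpos_outside_sector[of M _ "- k"])
        (use M m n \<phi>_def \<psi> False \<open>k \<noteq> 0\<close> in \<open>auto simp: k_def algebra_simps\<close>)
    then show ?thesis by auto
  qed
  have "s = cis (2 * real m * \<phi>)"
    by (simp add: m psk_point_def cis_conv_exp \<phi>_def mult_ac)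
  moreover have "y = of_real (cmod y) * cis \<theta>"
    using n(3) by (simp add: is_Arg_def cis_conv_exp)
  ultimately have "y * cnj s = of_real (cmod y) * cis \<psi>"
    by (metis (no_types, lifting) \<psi>_def cis_cnj cis_mult diff_conv_add_uminus mult.assoc)
  then have w: "Re (y * cnj s) = cmod y * cos \<psi>" "Im (y * cnj s) = cmod y * sin \<psi>"
    by simp_all
  have "Re (y * cnj s) * sin \<phi> \<le> Im (y * cnj s) * cos \<phi> \<or>
        Re (y * cnj s) * sin \<phi> \<le> - Im (y * cnj s) * cos \<phi>"
  proof -
    \<comment> \<open>By the addition formulas these products are the signed distances of the
      derotated \<open>y\<close> to the two boundary lines.\<close>
    have "cmod y * sin (\<phi> - \<psi>) \<le> 0 \<or> cmod y * sin (\<phi> + \<psi>) \<le> 0"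
      using sines by (meson mult_nonneg_nonpos norm_ge_zero)
    then show ?thesis unfolding w by (simp add: sin_diff sin_add algebra_simps) linarith
  qed
  moreover have "0 \<le> cos \<phi>"
    using M by (intro cos_ge_zero) (auto simp: \<phi>_def field_simps intro: order_trans[of _ 0])
  then have "Im (y * cnj s) * cos \<phi> \<le> \<bar>Im (y * cnj s)\<bar> * cos \<phi>"
    "- Im (y * cnj s) * cos \<phi> \<le> \<bar>Im (y * cnj s)\<bar> * cos \<phi>"
    by (intro mult_right_mono; simp)+
  ultimately show ?thesis unfolding \<phi>_def by linarith
qed

lemma SEP_le_safety_margin:
  assumes M: "M \<ge> 2" and v: "0 < v" and "prob_space \<Omega>" and s: "s \<in> psk M"
    and dec: "psk_decision M dec" and Z: "circular_complex_gaussian \<Omega> Z v"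
    and y: "\<And>w. w \<in> space \<Omega> \<Longrightarrow> y w = z + Z w"
  shows "SEP \<Omega> dec y s \<le> 2 * Q (safety_margin M z s * sin (pi / real M) / sqrt (v / 2))"
proof -
  interpret prob_space \<Omega> by fact
  define \<phi> where "\<phi> = pi / real M"
  define d where "d = safety_margin M z s * sin \<phi>"
  \<comment> \<open>For \<open>b = cos \<phi>\<close> and \<open>b = - cos \<phi>\<close>,
    \<open>Re (u b * e)\<close> is the component of the derotated \<open>e\<close> along the inner
    unit normal of the upper and the lower boundary line.\<close>
  define u where "u b = cnj s * Complex (sin \<phi>) b" for b
  define A where "A b = {w \<in> space \<Omega>. Re (u b * Z w) \<le> - d}" for b
  have "sin \<phi> > 0" using M by (intro sin_gt_zero) (auto simp: \<phi>_def field_simps)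
  then have d: "d = Re (z * cnj s) * sin \<phi> - \<bar>Im (z * cnj s)\<bar> * cos \<phi>"
    by (simp add: d_def safety_margin_def \<phi>_def[symmetric] cot_def field_simps)
  have "0 \<le> cos \<phi>"
    using M by (intro cos_ge_zero) (auto simp: \<phi>_def field_simps intro: order_trans[of _ 0])
  then have cos: "Im (z * cnj s) * cos \<phi> \<le> \<bar>Im (z * cnj s)\<bar> * cos \<phi>"
    "- Im (z * cnj s) * cos \<phi> \<le> \<bar>Im (z * cnj s)\<bar> * cos \<phi>"
    by (intro mult_right_mono; simp)+
  have "cmod s = 1" using s by (auto simp: psk_def psk_point_def)
  have prob_A: "prob (A b) = Q (d / sqrt (v / 2))" if "b = cos \<phi> \<or> b = - cos \<phi>" for b
    unfolding A_def
    by (rule prob_circular_complex_gaussian_halfplane[OF \<open>prob_space \<Omega>\<close> Z v])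
      (use that \<open>cmod s = 1\<close> in \<open>auto simp: u_def norm_mult complex_norm\<close>)
  have [measurable]: "Z \<in> borel_measurable \<Omega>"
    using Z by (simp add: circular_complex_gaussian_def)
  have A_sets: "A b \<in> events" for b unfolding A_def by measurable
  have u_Re: "Re (u b * e) = Re (e * cnj s) * sin \<phi> - Im (e * cnj s) * b" for b e
    by (simp add: u_def algebra_simps)
  have "{w \<in> space \<Omega>. dec (y w) \<noteq> s} \<subseteq> A (cos \<phi>) \<union> A (- cos \<phi>)"
  proof
    fix w assume "w \<in> {w \<in> space \<Omega>. dec (y w) \<noteq> s}"
    then have w: "w \<in> space \<Omega>" "dec (y w) \<noteq> s" by auto
    have "Re (y w * cnj s) * sin \<phi> \<le> \<bar>Im (y w * cnj s)\<bar> * cos \<phi>"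
      using psk_decision_error[OF M dec s w(2)] by (simp add: \<phi>_def)
    moreover have "Re (y w * cnj s) = Re (z * cnj s) + Re (Z w * cnj s)"
      "Im (y w * cnj s) = Im (z * cnj s) + Im (Z w * cnj s)"
      using y[OF w(1)] by (simp_all add: algebra_simps)
    ultimately have
      "(Re (z * cnj s) + Re (Z w * cnj s)) * sin \<phi> \<le> (Im (z * cnj s) + Im (Z w * cnj s)) * cos \<phi> \<or>
       (Re (z * cnj s) + Re (Z w * cnj s)) * sin \<phi> \<le> - (Im (z * cnj s) + Im (Z w * cnj s)) * cos \<phi>"
      by (metis abs_if)
    \<comment> \<open>The signed distance of \<open>z\<close> to either line is at least
      \<open>d\<close>, so crossing a line requires a noise component of at most \<open>- d\<close>
      along its normal. This also covers negative \<open>d\<close>, when \<open>z\<close> lies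
      outside the sector.\<close>
    then have "Re (u (cos \<phi>) * Z w) \<le> - d \<or> Re (u (- cos \<phi>) * Z w) \<le> - d"
      using cos unfolding u_Re d distrib_right minus_add_distrib mult_minus_left mult_minus_right
      by linarith
    then show "w \<in> A (cos \<phi>) \<union> A (- cos \<phi>)" using w by (auto simp: A_def)
  qed
  then have "SEP \<Omega> dec y s \<le> prob (A (cos \<phi>) \<union> A (- cos \<phi>))"
    unfolding SEP_def by (intro finite_measure_mono) (auto simp: A_sets)
  also have "\<dots> \<le> prob (A (cos \<phi>)) + prob (A (- cos \<phi>))"
    by (intro measure_Un_le A_sets)
  finally show ?thesis by (simp add: prob_A d_def \<phi>_def)
qed

theorem corollary1:
  fixes M K T :: nat
    and \<sigma> P :: real
    and h :: "nat \<Rightarrow> complex ^ 'n::finite"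
    and x :: "nat \<Rightarrow> complex ^ 'n"
    and s :: "nat \<Rightarrow> nat \<Rightarrow> complex"
    and dec :: "complex \<Rightarrow> complex"
    and \<Omega> :: "'w measure"
    and \<eta> y :: "nat \<Rightarrow> nat \<Rightarrow> 'w \<Rightarrow> complex"
  assumes "M \<ge> 2" and "K \<ge> 1" and "T \<ge> 1"
    and "\<sigma> > 0" and "P > 0"
    and "\<forall>i\<in>{1..K}. \<forall>t\<in>{1..T}. s i t \<in> psk M"
    and "\<forall>t\<in>{1..T}. x t \<in> one_bit_signals P"
    and "psk_decision M dec"
    and "prob_space \<Omega>"
    and "\<forall>i\<in>{1..K}. \<forall>t\<in>{1..T}. circular_complex_gaussian \<Omega> (\<eta> i t) (\<sigma>\<^sup>2)"
    and "\<forall>i\<in>{1..K}. \<forall>t\<in>{1..T}. \<forall>\<omega>\<in>space \<Omega>. y i t \<omega> = tdot (h i) (x t) + \<eta> i t \<omega>"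
  shows "\<forall>i\<in>{1..K}. \<forall>t\<in>{1..T}.
           SEP \<Omega> dec (y i t) (s i t)
             \<le> 2 * Q (safety_margin M (tdot (h i) (x t)) (s i t) / (\<sigma> / sqrt 2) * sin (pi / real M))"
proof (intro ballI)
  fix i t assume it: "i \<in> {1..K}" "t \<in> {1..T}"
  have "SEP \<Omega> dec (y i t) (s i t)
      \<le> 2 * Q (safety_margin M (tdot (h i) (x t)) (s i t) * sin (pi / real M) / sqrt (\<sigma>\<^sup>2 / 2))"
    by (rule SEP_le_safety_margin[where Z = "\<eta> i t"]) (use assms it in auto)
  \<comment> \<open>Each real component carries half of the complex variance, which gives the
    divisor \<open>\<sigma> / sqrt 2\<close>.\<close>
  moreover have "sqrt (\<sigma>\<^sup>2 / 2) = \<sigma> / sqrt 2"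
    using \<open>\<sigma> > 0\<close> by (simp add: real_sqrt_divide)
  ultimately show "SEP \<Omega> dec (y i t) (s i t)
      \<le> 2 * Q (safety_margin M (tdot (h i) (x t)) (s i t) / (\<sigma> / sqrt 2) * sin (pi / real M))"
    by (simp add: mult_ac)
qed

end
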